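(* Let $T\in\mathbb{F}^{n_1}\otimes\mathbb{F}^{n_2}\otimes\mathbb{F}^{n_3}$ be any tensor and suppose $|\mathbb{F}|>\underline{Q}(T)+1$. Then for every $i\in[3]$, $\underline{Q}(T)\leq Q_i(T)$.
   Context: The border subrank $\underline{Q}(T)$ is the largest $r$ such that there are matrices $A(\varepsilon),B(\varepsilon),C(\varepsilon)$ with entries Laurent polynomials over $\mathbb{F}$ in a formal variable $\varepsilon$ with $(A(\varepsilon)\otimes B(\varepsilon)\otimes C(\varepsilon))T=\sum_{i=1}^re_i\otimes e_i\otimes e_i+\varepsilon S_1+\cdots+\varepsilon^tS_t$ for some tensors $S_1,\dots,S_t$ over $\mathbb{F}$. For $\ell\in[3]$, the $\ell$-slices of $T=\sum T_{a_1,a_2,a_3}e_{a_1}\otimes e_{a_2}\otimes e_{a_3}$ are the matrices obtained by fixing the $\ell$-th index $a_\ell$, and $Q_\ell(T)$ is the maximum rank of an element of the linear span of the $\ell$-slices. *)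

theory Defs
  imports
    "HOL-Computational_Algebra.Formal_Laurent_Series"
    "Jordan_Normal_Form.DL_Rank"
begin

text \<open>
  An \<open>n1 \<times> n2 \<times> n3\<close> tensor over a field \<open>F\<close> is given by its coordinate function; only the entries
  \<open>T a b c\<close> with \<open>a < n1\<close>, \<open>b < n2\<close>, \<open>c < n3\<close> matter, and no definition below looks at others.
  Indices start at \<open>0\<close>.
\<close>

type_synonym 'a tensor = "nat \<Rightarrow> nat \<Rightarrow> nat \<Rightarrow> 'a"

text \<open>The tensor \<open>(A \<otimes> B \<otimes> C) T\<close>, where \<open>A\<close>, \<open>B\<close>, \<open>C\<close> have \<open>n1\<close>, \<open>n2\<close>, \<open>n3\<close> columns.\<close>

definition tensor_action ::
    "'b::comm_semiring_1 mat \<Rightarrow> 'b mat \<Rightarrow> 'b mat \<Rightarrow> 'b tensor \<Rightarrow> 'b tensor" where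
  "tensor_action A B C T = (\<lambda>i j k.
     \<Sum>a<dim_col A. \<Sum>b<dim_col B. \<Sum>c<dim_col C. A $$ (i, a) * B $$ (j, b) * C $$ (k, c) * T a b c)"

definition unit_tensor :: "'b::zero_neq_one tensor" where
  "unit_tensor = (\<lambda>i j k. if i = j \<and> j = k then 1 else 0)"

text \<open>
  Laurent polynomials over \<open>F\<close> in \<open>\<epsilon>\<close> are the formal Laurent series with finitely many nonzero
  coefficients; \<open>fls_X\<close> plays the role of \<open>\<epsilon>\<close>.
\<close>

definition laurent_polynomials :: "'a::zero fls set" where
  "laurent_polynomials = {f. finite {n. fls_nth f n \<noteq> 0}}"

definition laurent_polynomial_mats :: "nat \<Rightarrow> nat \<Rightarrow> 'a::zero fls mat set" where
  "laurent_polynomial_mats nr nc =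
     {A \<in> carrier_mat nr nc. \<forall>i<nr. \<forall>j<nc. A $$ (i, j) \<in> laurent_polynomials}"

definition unit_tensor_degenerates ::
    "nat \<Rightarrow> nat \<Rightarrow> nat \<Rightarrow> 'a::field tensor \<Rightarrow> nat \<Rightarrow> bool" where
  "unit_tensor_degenerates n1 n2 n3 T r \<longleftrightarrow>
     (\<exists>A \<in> laurent_polynomial_mats r n1. \<exists>B \<in> laurent_polynomial_mats r n2.
      \<exists>C \<in> laurent_polynomial_mats r n3. \<exists>t::nat. \<exists>S :: nat \<Rightarrow> 'a tensor.
        \<forall>i<r. \<forall>j<r. \<forall>k<r.
          tensor_action A B C (\<lambda>a b c. fls_const (T a b c)) i j k =
            unit_tensor i j k + (\<Sum>s=1..t. fls_X ^ s * fls_const (S s i j k)))"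

text \<open>
  The set is nonempty (it contains \<open>0\<close>) and bounded by each of \<open>n1\<close>, \<open>n2\<close>, \<open>n3\<close>, since over the
  field of Laurent series the flattenings of \<open>unit_tensor + \<epsilon> S\<^sub>1 + \<dots>\<close> have rank \<open>r\<close>.
\<close>

definition border_subrank :: "nat \<Rightarrow> nat \<Rightarrow> nat \<Rightarrow> 'a::field tensor \<Rightarrow> nat" where
  "border_subrank n1 n2 n3 T = Max {r. unit_tensor_degenerates n1 n2 n3 T r}"

text \<open>The \<open>l\<close>-slices, \<open>l \<in> {1, 2, 3}\<close>; the two remaining indices keep their order.\<close>

definition slices1 :: "nat \<Rightarrow> nat \<Rightarrow> nat \<Rightarrow> 'a tensor \<Rightarrow> 'a mat set" where
  "slices1 n1 n2 n3 T = (\<lambda>a. mat n2 n3 (\<lambda>(b, c). T a b c)) ` {..<n1}"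

definition slices2 :: "nat \<Rightarrow> nat \<Rightarrow> nat \<Rightarrow> 'a tensor \<Rightarrow> 'a mat set" where
  "slices2 n1 n2 n3 T = (\<lambda>b. mat n1 n3 (\<lambda>(a, c). T a b c)) ` {..<n2}"

definition slices3 :: "nat \<Rightarrow> nat \<Rightarrow> nat \<Rightarrow> 'a tensor \<Rightarrow> 'a mat set" where
  "slices3 n1 n2 n3 T = (\<lambda>c. mat n1 n2 (\<lambda>(a, b). T a b c)) ` {..<n3}"

definition mat_span :: "nat \<Rightarrow> nat \<Rightarrow> 'a::field mat set \<Rightarrow> 'a mat set" where
  "mat_span nr nc S = module.span class_ring (module_mat TYPE('a) nr nc) S"

definition max_rank_span :: "nat \<Rightarrow> nat \<Rightarrow> 'a::field mat set \<Rightarrow> nat" where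
  "max_rank_span nr nc S = Max (vec_space.rank nr ` mat_span nr nc S)"

text \<open>\<open>Q\<^sub>l(T)\<close> for \<open>l \<in> {1, 2, 3}\<close>; other values of \<open>l\<close> are meaningless.\<close>

definition max_slice_rank :: "nat \<Rightarrow> nat \<Rightarrow> nat \<Rightarrow> nat \<Rightarrow> 'a::field tensor \<Rightarrow> nat" where
  "max_slice_rank l n1 n2 n3 T =
     (if l = 1 then max_rank_span n2 n3 (slices1 n1 n2 n3 T)
      else if l = 2 then max_rank_span n1 n3 (slices2 n1 n2 n3 T)
      else max_rank_span n1 n2 (slices3 n1 n2 n3 T))"

text \<open>Well-definedness of the maximum, and the span of a finite family of matrices in coordinates.\<close>

lemma mat_span_carrier:
  fixes S :: "'a::field mat set"
  assumes "S \<subseteq> carrier_mat nr nc"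
  shows "mat_span nr nc S \<subseteq> carrier_mat nr nc"
proof -
  interpret M: matrix_vs nr nc "TYPE('a)" .
  show ?thesis unfolding mat_span_def using M.span_is_subset2[OF assms] .
qed

lemma finite_ranks_mat_span:
  fixes S :: "'a::field mat set"
  assumes "S \<subseteq> carrier_mat nr nc"
  shows "finite (vec_space.rank nr ` mat_span nr nc S)"
proof (rule finite_subset)
  show "vec_space.rank nr ` mat_span nr nc S \<subseteq> {..nc}"
    using mat_span_carrier[OF assms] vec_space.rank_le_nc[where 'a = 'a] by blast
qed simp

lemma mat_span_image:
  fixes f :: "nat \<Rightarrow> nat \<Rightarrow> nat \<Rightarrow> 'a::field"
  shows "mat_span nr nc ((\<lambda>a. mat nr nc (\<lambda>(i, j). f a i j)) ` {..<n}) =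
         range (\<lambda>w. mat nr nc (\<lambda>(i, j). \<Sum>a<n. w a * f a i j))" (is "?L = ?R")
proof -
  interpret M: matrix_vs nr nc "TYPE('a)" .
  let ?g = "\<lambda>a. mat nr nc (\<lambda>(i, j). f a i j)"
  let ?c = "\<lambda>n (w :: nat \<Rightarrow> 'a). mat nr nc (\<lambda>(i, j). \<Sum>a<n. w a * f a i j)"
  let ?sp = "M.span (?g ` {..<n})"
  have S: "?g ` {..<n} \<subseteq> carrier_mat nr nc" by auto
  have sub: "submodule class_ring ?sp M.V"
    by (rule M.span_is_submodule[OF S])
  have cl: "?c m w \<in> ?sp" if "m \<le> n" for m w
    using that
  proof (induction m)
    case 0
    have eq: "?c 0 w = 0\<^sub>m nr nc" by (intro eq_matI) auto
    show ?case unfolding eq by (rule M.span_zero)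
  next
    case (Suc m)
    have eq: "?c (Suc m) w = ?c m w + w m \<cdot>\<^sub>m ?g m" by (intro eq_matI) auto
    have g: "?g m \<in> ?sp" using Suc.prems M.in_own_span[OF S] by auto
    have sg: "w m \<cdot>\<^sub>m ?g m \<in> ?sp"
      using submodule.smult_closed[OF sub, of "w m" "?g m"] g
      by (simp add: module_mat_simps class_ring_simps)
    have "?c m w + w m \<cdot>\<^sub>m ?g m \<in> ?sp"
      using M.span_add1[OF S _ sg] Suc by simp
    then show ?case by (simp only: eq)
  qed
  have "module class_ring M.V" using M.module_axioms .
  then have subR: "submodule class_ring ?R M.V"
  proof (rule submodule.intro)
    show "v \<oplus>\<^bsub>M.V\<^esub> w \<in> ?R" if vw: "v \<in> ?R" "w \<in> ?R" for v w
    proof -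
      obtain x y where "v = ?c n x" "w = ?c n y" using vw by auto
      then have "v \<oplus>\<^bsub>M.V\<^esub> w = ?c n (\<lambda>a. x a + y a)"
        by (auto simp: module_mat_simps sum.distrib distrib_right)
      then show ?thesis by (rule range_eqI[where x = "\<lambda>a. x a + y a"])
    qed
    have "\<zero>\<^bsub>M.V\<^esub> = ?c n (\<lambda>_. 0)" by (auto simp: module_mat_simps)
    then show "\<zero>\<^bsub>M.V\<^esub> \<in> ?R" by (rule range_eqI[where x = "\<lambda>_. 0"])
    show "c \<odot>\<^bsub>M.V\<^esub> v \<in> ?R" if v: "v \<in> ?R" for c v
    proof -
      obtain x where "v = ?c n x" using v by auto
      then have "c \<odot>\<^bsub>M.V\<^esub> v = ?c n (\<lambda>a. c * x a)"
        by (auto simp: module_mat_simps sum_distrib_left mult.assoc)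
      then show ?thesis by (rule range_eqI[where x = "\<lambda>a. c * x a"])
    qed
  qed (auto simp: module_mat_simps)
  have "?g ` {..<n} \<subseteq> ?R"
  proof
    fix v assume "v \<in> ?g ` {..<n}"
    then obtain a where a: "a < n" "v = ?g a" by auto
    have "(\<Sum>b<n. (if b = a then 1 else 0) * f b i j) = f a i j" for i j
      using a by (simp add: if_distrib[of "\<lambda>x. x * _"] cong: if_cong)
    then have "v = ?c n (\<lambda>b. if b = a then 1 else 0)" using a by simp
    then show "v \<in> ?R" by (rule range_eqI[where x = "\<lambda>b. if b = a then 1 else 0"])
  qed
  then have "?sp \<subseteq> ?R" using M.span_is_subset subR by blast
  moreover have "?R \<subseteq> ?sp" using cl by auto
  ultimately show ?thesis unfolding mat_span_def by auto
qed

end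

theory Submission
  imports Defs
begin

text \<open>
  Let \<open>r\<close> be the border subrank. Contracting \<open>(A \<otimes> B \<otimes> C) T = unit_tensor + O(\<epsilon>)\<close> with the
  all-ones vector in the first mode (the others are alike) gives \<open>B M C\<^sup>T = 1 + O(\<epsilon>)\<close>, where
  \<open>M = \<Sum>\<^sub>a w\<^sub>a T\<^sub>a\<close> is a combination of slices with coefficients in the Laurent series. So
  \<open>det (B M C\<^sup>T) \<noteq> 0\<close>. This determinant has degree at most \<open>r\<close> in each \<open>w\<^sub>a\<close>, and \<open>F\<close> has more
  than \<open>r\<close> elements, so the weights can be moved into \<open>F\<close> one at a time without making it
  vanish. Then \<open>M\<close> lies in the span of the slices over \<open>F\<close>, and a factorization of \<open>M\<close> through
  \<open>F\<^sup>s\<close> with \<open>s = rank M < r\<close> would force the determinant to be zero.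
\<close>

section \<open>Determinants and ranks of matrix products\<close>

lemma det_mult_dim_less:
  fixes P Q :: "'a::field mat"
  assumes P: "P \<in> carrier_mat r s" and Q: "Q \<in> carrier_mat s r" and "s < r"
  shows "det (P * Q) = 0"
proof -
  \<comment> \<open>Zero padding turns both factors into square matrices with the same product. Row
    \<open>s\<close> of \<open>Q'\<close> exists because \<open>s < r\<close>, and it is
    zero.\<close>
  define P' where "P' = mat r r (\<lambda>(i, j). if j < s then P $$ (i, j) else 0)"
  define Q' where "Q' = mat r r (\<lambda>(i, j). if i < s then Q $$ (i, j) else 0)"
  have "(\<Sum>k = 0..<r. P' $$ (i, k) * Q' $$ (k, j)) = (\<Sum>k = 0..<s. P $$ (i, k) * Q $$ (k, j))"
    if "i < r" "j < r" for i j
    using that \<open>s < r\<close> by (intro sum.mono_neutral_cong_right) (auto simp: P'_def Q'_def)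
  then have eq: "P * Q = P' * Q'"
    using P Q by (intro eq_matI) (auto simp: P'_def Q'_def scalar_prod_def)
  have carr: "P' \<in> carrier_mat r r" "Q' \<in> carrier_mat r r" by (auto simp: P'_def Q'_def)
  have "Q' = mat\<^sub>r r r (\<lambda>i. if i = s then 0\<^sub>v r else row Q' i)"
    using \<open>s < r\<close> by (intro eq_matI) (auto simp: Q'_def)
  then have "det Q' = 0"
    using det_row_0[OF \<open>s < r\<close>, of "row Q'"] carr by auto
  then show ?thesis
    unfolding eq det_mult[OF carr] by simp
qed

text \<open>A maximal independent set of columns has \<open>rank A\<close> elements and spans every
  column of \<open>A\<close>. These columns form \<open>U\<close>, and the coordinates of all
  columns with respect to them form \<open>V\<close>.\<close>

lemma rank_factorization:
  fixes A :: "'a::field mat"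
  assumes A: "A \<in> carrier_mat n nc"
  obtains U V where "U \<in> carrier_mat n (vec_space.rank n A)"
    "V \<in> carrier_mat (vec_space.rank n A) nc" "A = U * V"
proof -
  interpret vec_space "TYPE('a)" n .
  let ?P = "\<lambda>T. T \<subseteq> set (cols A) \<and> lin_indpt T"
  have S: "set (cols A) \<subseteq> carrier_vec n" using A cols_dim by blast
  have "?P {}" by (auto simp: lin_dep_def)
  then obtain W where W: "finite W" "maximal W ?P"
    using maximal_exists_superset[of "set (cols A)" ?P "{}"] by auto
  then have WS: "W \<subseteq> set (cols A)" and indep: "lin_indpt W" by (auto simp: maximal_def)
  have rank: "rank A = card W" by (rule rank_card_indpt[OF A W(2)])
  have span: "v \<in> span W" if v: "v \<in> set (cols A)" for v
  proof (rule ccontr)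
    assume nin: "v \<notin> span W"
    then have "v \<notin> W" using WS S span_mem by (meson subset_trans)
    have "lin_indpt (W \<union> {v})"
      using lin_dep_iff_in_span[of W v] WS S indep v nin \<open>v \<notin> W\<close> by auto
    then have "W \<union> {v} = W" using W(2) WS v unfolding maximal_def by blast
    with \<open>v \<notin> W\<close> show False by auto
  qed
  obtain ws where ws: "set ws = W" "distinct ws" using finite_distinct_list[OF W(1)] by auto
  have wsn: "set ws \<subseteq> carrier_vec n" using ws WS S by auto
  have "\<exists>x. col A j = mat_of_cols n ws *\<^sub>v vec (length ws) x" if j: "j < nc" for j
  proof -
    have "col A j \<in> span (set ws)" using span[of "col A j"] j A ws by (auto simp: cols_def)
    then obtain f where "col A j = lincomb f (set ws)"
      using finite_in_span[OF finite_set wsn] by metis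
    also have "\<dots> = lincomb_list (\<lambda>i. f (ws ! i)) ws"
      by (rule lincomb_as_lincomb_list_distinct[OF wsn ws(2)])
    also have "\<dots> = mat_of_cols n ws *\<^sub>v vec (length ws) (\<lambda>i. f (ws ! i))"
      using wsn by (intro lincomb_list_as_mat_mult) auto
    finally show ?thesis by blast
  qed
  then obtain x where x: "\<And>j. j < nc \<Longrightarrow> col A j = mat_of_cols n ws *\<^sub>v vec (length ws) (x j)"
    by metis
  have len: "length ws = rank A" using rank ws distinct_card by metis
  let ?V = "mat (length ws) nc (\<lambda>(i, j). x j i)"
  have "A = mat_of_cols n ws * ?V"
  proof (rule mat_col_eqI)
    fix j assume "j < dim_col (mat_of_cols n ws * ?V)"
    then have j: "j < nc" by simp
    have "col ?V j = vec (length ws) (x j)" using j by (intro eq_vecI) auto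
    then show "col A j = col (mat_of_cols n ws * ?V) j"
      using x[OF j] j by (simp add: col_mult2[of _ n "length ws" _ nc])
  qed (use A in auto)
  then show thesis
    by (intro that[of "mat_of_cols n ws" ?V]) (auto simp: len)
qed

section \<open>Nonvanishing determinants\<close>

lemma fls_det_ne_0_if_identity_at_0:
  fixes M :: "'a::field fls mat"
  assumes M: "M \<in> carrier_mat r r"
    and nth: "\<And>i j m. i < r \<Longrightarrow> j < r \<Longrightarrow> m \<le> 0 \<Longrightarrow>
      fls_nth (M $$ (i, j)) m =
        (if m = 0 \<and> i = j then 1 else 0)"
  shows "det M \<noteq> 0"
proof -
  interpret E: comm_ring_hom "fps_to_fls :: 'a fps \<Rightarrow> 'a fls"
    by unfold_locales (auto simp: fls_times_fps_to_fls)
  interpret Z: comm_ring_hom "\<lambda>f :: 'a fps. fps_nth f 0"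
    by unfold_locales auto
  \<comment> \<open>The entries of \<open>M\<close> have no negative powers, so \<open>M\<close>
    comes from the power series matrix \<open>G\<close>. Taking constant terms is a ring
    homomorphism that sends \<open>G\<close> to the identity, so \<open>det G\<close> has constant
    term 1.\<close>
  define G where "G = map_mat fls_regpart M"
  have G: "G \<in> carrier_mat r r" using M by (auto simp: G_def)
  have "map_mat fps_to_fls G = M"
    using M nth by (intro eq_matI) (auto simp: G_def intro!: fls_eqI)
  then have "det M = fps_to_fls (det G)" using E.hom_det[of G] by simp
  moreover have "map_mat (\<lambda>f. fps_nth f 0) G = 1\<^sub>m r"
    using M nth by (intro eq_matI) (auto simp: G_def)
  then have "fps_nth (det G) 0 = 1" using Z.hom_det[of G] by simp
  then have "det G \<noteq> 0" by auto
  ultimately show ?thesis by simp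
qed

text \<open>Changing one weight at a time uses only the degree in that weight, which is at most
  \<open>r\<close>. The set \<open>F\<close> will be the copy of the base field inside its Laurent
  series.\<close>

lemma det_linear_combination_ne_0_in_subset:
  fixes N :: "nat \<Rightarrow> nat \<Rightarrow> nat \<Rightarrow> 'k::field" and F :: "'k set"
  assumes F: "infinite F \<or> card F > r"
    and w: "det (mat r r (\<lambda>(i, j). \<Sum>a<n. w a * N a i j)) \<noteq> 0"
  obtains v where "\<And>a. a < n \<Longrightarrow> v a \<in> F"
    "det (mat r r (\<lambda>(i, j). \<Sum>a<n. v a * N a i j)) \<noteq> 0"
proof -
  let ?D = "\<lambda>v. det (mat r r (\<lambda>(i, j). \<Sum>a<n. v a * N a i j))"
  \<comment> \<open>Induction on the number of weights already in \<open>F\<close>; the later ones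
    are still arbitrary in \<open>'k\<close>.\<close>
  have "\<exists>v. (\<forall>a<m. v a \<in> F) \<and> ?D v \<noteq> 0" if "m \<le> n" for m
    using that
  proof (induction m)
    case 0
    show ?case using w by blast
  next
    case (Suc m)
    then obtain v where v: "\<forall>a<m. v a \<in> F" "?D v \<noteq> 0" by auto
    \<comment> \<open>Weight \<open>m\<close> becomes an indeterminate: it multiplies
      \<open>N m i j\<close>, and the other weights make up the constant coefficient.\<close>
    define p where "p = det (mat r r (\<lambda>(i, j). [:\<Sum>a\<in>{..<n} - {m}. v a * N a i j, N m i j:]))"
    have p: "poly p x = ?D (v(m := x))" for x
    proof -
      interpret comm_ring_hom "\<lambda>q :: 'k poly. poly q x" by unfold_locales auto
      have "(\<Sum>a<n. (v(m := x)) a * N a i j) = x * N m i j + (\<Sum>a\<in>{..<n} - {m}. v a * N a i j)"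
        for i j
        using Suc.prems by (subst sum.remove[of _ m]) (auto intro!: sum.cong)
      then show ?thesis
        unfolding p_def hom_det[symmetric]
        by (intro arg_cong[where f = det] eq_matI) auto
    qed
    \<comment> \<open>The old weight \<open>v m\<close> is not a root of \<open>p\<close>, so
      \<open>p\<close> is not the zero polynomial.\<close>
    have "v(m := v m) = v" by simp
    then have "p \<noteq> 0" using p[of "v m"] v(2) by fastforce
    have "degree p \<le> 1 * r" unfolding p_def by (rule degree_det_le) auto
    then have "card {x. poly p x = 0} \<le> r"
      using card_poly_roots_bound[OF \<open>p \<noteq> 0\<close>] by simp
    then have "\<not> F \<subseteq> {x. poly p x = 0}"
      using F poly_roots_finite[OF \<open>p \<noteq> 0\<close>] card_mono[of "{x. poly p x = 0}" F] finite_subset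
      by fastforce
    then obtain x where "x \<in> F" "poly p x \<noteq> 0" by auto
    then show ?case
      using v(1) by (intro exI[of _ "v(m := x)"]) (auto simp: p less_Suc_eq)
  qed
  then show thesis using that by blast
qed

section \<open>Contracting one mode of a tensor\<close>

lemma fls_const_sum: "fls_const (sum f A) = (\<Sum>x\<in>A. fls_const (f x))"
  for f :: "'b \<Rightarrow> 'a::comm_monoid_add"
  by (induction A rule: infinite_finite_induct) (auto simp: fls_plus_const[symmetric])

text \<open>This is \<open>B M C\<^sup>T\<close> for the weighted sum \<open>M\<close> of slices,
  expanded so that it is visibly linear in \<open>w\<close>, as the replacement of weights requires.
  The contracted mode is the first argument of \<open>f\<close>, so one definition serves all three
  modes.\<close>

definition contraction ::
  "nat \<Rightarrow> nat \<Rightarrow> nat \<Rightarrow> nat \<Rightarrow> (nat \<Rightarrow> 'b) \<Rightarrow>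
    'b mat \<Rightarrow> 'b mat \<Rightarrow> 'b::comm_semiring_1 tensor \<Rightarrow> 'b mat" where
  "contraction r n nr nc w B C f =
     mat r r (\<lambda>(i, j). \<Sum>a<n. w a * (\<Sum>b<nr. \<Sum>c<nc. B $$ (i, b) * C $$ (j, c) * f a b c))"

lemma contraction_eq_mult:
  assumes "B \<in> carrier_mat r nr" "C \<in> carrier_mat r nc"
  shows "contraction r n nr nc w B C f =
    B * (mat nr nc (\<lambda>(b, c). \<Sum>a<n. w a * f a b c) * transpose_mat C)"
proof (rule eq_matI)
  fix i j
  assume "i < dim_row (B * (mat nr nc (\<lambda>(b, c). \<Sum>a<n. w a * f a b c) * transpose_mat C))"
    "j < dim_col (B * (mat nr nc (\<lambda>(b, c). \<Sum>a<n. w a * f a b c) * transpose_mat C))"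
  then have ij: "i < r" "j < r" using assms by auto
  have "contraction r n nr nc w B C f $$ (i, j) =
      (\<Sum>a<n. \<Sum>b<nr. \<Sum>c<nc. B $$ (i, b) * (w a * f a b c * C $$ (j, c)))"
    using ij by (simp add: contraction_def sum_distrib_left mult_ac)
  also have "\<dots> = (\<Sum>b<nr. \<Sum>c<nc. \<Sum>a<n. B $$ (i, b) * (w a * f a b c * C $$ (j, c)))"
    by (subst sum.swap) (auto intro!: sum.cong sum.swap)
  finally show "contraction r n nr nc w B C f $$ (i, j) =
      (B * (mat nr nc (\<lambda>(b, c). \<Sum>a<n. w a * f a b c) * transpose_mat C)) $$ (i, j)"
    using assms ij
    by (simp add: scalar_prod_def sum_distrib_left sum_distrib_right atLeast0LessThan)
qed (use assms in \<open>auto simp: contraction_def\<close>)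

text \<open>If \<open>r > nr\<close>, the product factors through dimension \<open>nr < r\<close>.
  This bound makes the set of degenerating \<open>r\<close> finite.\<close>

lemma contraction_det_ne_0_imp_le_dim:
  fixes B C :: "'b::field mat"
  assumes "B \<in> carrier_mat r nr" "C \<in> carrier_mat r nc" "det (contraction r n nr nc w B C f) \<noteq> 0"
  shows "r \<le> nr"
proof (rule ccontr)
  assume "\<not> r \<le> nr"
  then have "det (contraction r n nr nc w B C f) = 0"
    unfolding contraction_eq_mult[OF assms(1,2)]
    by (intro det_mult_dim_less[OF assms(1)]) (use assms(2) in auto)
  with assms show False by simp
qed

lemma contraction_det_ne_0_imp_le_max_rank_span:
  fixes B C :: "'a::field fls mat" and f :: "'a tensor"
  assumes B: "B \<in> carrier_mat r nr" and C: "C \<in> carrier_mat r nc"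
    and w: "det (contraction r n nr nc w B C (\<lambda>a b c. fls_const (f a b c))) \<noteq> 0"
    and F: "infinite (UNIV :: 'a set) \<or> card (UNIV :: 'a set) > r"
  shows "r \<le> max_rank_span nr nc ((\<lambda>a. mat nr nc (\<lambda>(b, c). f a b c)) ` {..<n})"
proof -
  let ?f = "\<lambda>a b c. fls_const (f a b c)"
  interpret H: comm_ring_hom "fls_const :: 'a \<Rightarrow> 'a fls"
    by unfold_locales (auto simp: fls_plus_const)
  have inj: "inj (fls_const :: 'a \<Rightarrow> 'a fls)"
    by (rule injI) (metis fls_const_nth)
  have "infinite (range (fls_const :: 'a \<Rightarrow> 'a fls)) \<or> card (range (fls_const :: 'a \<Rightarrow> 'a fls)) > r"
    using F inj by (simp add: card_image finite_image_iff)
  \<comment> \<open>\<open>B\<close> and \<open>C\<close> stay over the Laurent series; only the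
    weights move into the constants, of which there are as many as elements of
    \<open>'a\<close>.\<close>
  then obtain v where v: "\<And>a. a < n \<Longrightarrow> v a \<in> range (fls_const :: 'a \<Rightarrow> 'a fls)"
    "det (contraction r n nr nc v B C ?f) \<noteq> 0"
    using w unfolding contraction_def
    by (rule det_linear_combination_ne_0_in_subset) blast
  define u where "u a = inv_into UNIV fls_const (v a)" for a
  have u: "v a = fls_const (u a)" if "a < n" for a
    using v(1)[OF that] by (simp add: u_def f_inv_into_f)
  define M where "M = mat nr nc (\<lambda>(b, c). \<Sum>a<n. u a * f a b c)"
  have M: "M \<in> carrier_mat nr nc" by (simp add: M_def)
  have vM: "mat nr nc (\<lambda>(b, c). \<Sum>a<n. v a * ?f a b c) = map_mat fls_const M"
    by (intro eq_matI) (auto simp: M_def fls_const_sum u)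
  have det: "det (B * (map_mat fls_const M * transpose_mat C)) \<noteq> 0"
    using v(2) unfolding contraction_eq_mult[OF B C] vM .
  have "r \<le> vec_space.rank nr M"
  proof (rule ccontr)
    let ?s = "vec_space.rank nr M"
    assume less: "\<not> r \<le> ?s"
    obtain U V where U: "U \<in> carrier_mat nr ?s" and V: "V \<in> carrier_mat ?s nc" and UV: "M = U * V"
      by (rule rank_factorization[OF M])
    let ?U = "map_mat fls_const U" and ?V = "map_mat fls_const V"
    have carr: "?U \<in> carrier_mat nr ?s" "?V \<in> carrier_mat ?s nc" "transpose_mat C \<in> carrier_mat nc r"
      using U V C by auto
    \<comment> \<open>Transporting the factorization over \<open>'a\<close> along
      \<open>fls_const\<close> takes the place of comparing ranks over the two fields.\<close>
    have "map_mat fls_const M = ?U * ?V" using H.mat_hom_mult[OF U V] UV by simp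
    then have "B * (map_mat fls_const M * transpose_mat C) = (B * ?U) * (?V * transpose_mat C)"
      by (simp only: assoc_mult_mat[OF carr] assoc_mult_mat[OF B carr(1) mult_carrier_mat[OF carr(2,3)]])
    moreover have "det ((B * ?U) * (?V * transpose_mat C)) = 0"
      using less B carr by (intro det_mult_dim_less[of _ r ?s]) auto
    ultimately show False using det by simp
  qed
  also have "\<dots> \<le> max_rank_span nr nc ((\<lambda>a. mat nr nc (\<lambda>(b, c). f a b c)) ` {..<n})"
    unfolding max_rank_span_def
  proof (rule Max_ge)
    show "finite (vec_space.rank nr ` mat_span nr nc ((\<lambda>a. mat nr nc (\<lambda>(b, c). f a b c)) ` {..<n}))"
      by (rule finite_ranks_mat_span) auto
    show "vec_space.rank nr M \<in>
        vec_space.rank nr ` mat_span nr nc ((\<lambda>a. mat nr nc (\<lambda>(b, c). f a b c)) ` {..<n})"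
      unfolding mat_span_image M_def by blast
  qed
  finally show ?thesis .
qed

section \<open>From degenerations to contractions\<close>

lemma unit_tensor_degenerates_contractions:
  fixes T :: "'a::field tensor"
  assumes "unit_tensor_degenerates n1 n2 n3 T r"
  obtains A B C wa wb wc where
    "A \<in> carrier_mat r n1" "B \<in> carrier_mat r n2" "C \<in> carrier_mat r n3"
    "det (contraction r n1 n2 n3 wa B C (\<lambda>a b c. fls_const (T a b c))) \<noteq> 0"
    "det (contraction r n2 n1 n3 wb A C (\<lambda>b a c. fls_const (T a b c))) \<noteq> 0"
    "det (contraction r n3 n1 n2 wc A B (\<lambda>c a b. fls_const (T a b c))) \<noteq> 0"
proof -
  let ?T = "\<lambda>a b c. fls_const (T a b c)"
  from assms obtain A B C t and S :: "nat \<Rightarrow> 'a tensor" where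
    mats: "A \<in> laurent_polynomial_mats r n1" "B \<in> laurent_polynomial_mats r n2"
      "C \<in> laurent_polynomial_mats r n3"
    and all: "\<forall>i<r. \<forall>j<r. \<forall>k<r. tensor_action A B C ?T i j k =
            unit_tensor i j k + (\<Sum>s=1..t. fls_X ^ s * fls_const (S s i j k))"
    unfolding unit_tensor_degenerates_def by (elim bexE exE) rule
  from mats have carr: "A \<in> carrier_mat r n1" "B \<in> carrier_mat r n2" "C \<in> carrier_mat r n3"
    by (simp_all add: laurent_polynomial_mats_def)
  note eq = all[rule_format]
  \<comment> \<open>At exponents \<open>m \<le> 0\<close> the terms with \<open>s \<ge> 1\<close>
    contribute nothing, whatever the tensors \<open>S s\<close> are.\<close>
  have nth: "fls_nth (tensor_action A B C ?T i j k) m = (if m = 0 \<and> i = j \<and> j = k then 1 else 0)"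
    if "i < r" "j < r" "k < r" "m \<le> 0" for i j k m
  proof -
    have "fls_nth (\<Sum>s=1..t. fls_X ^ s * fls_const (S s i j k)) m = 0"
      using that by (simp add: fls_nth_sum fls_X_power_times_conv_shift)
    then show ?thesis using that by (simp add: eq unit_tensor_def)
  qed
  have ta: "tensor_action A B C ?T i j k =
      (\<Sum>a<n1. \<Sum>b<n2. \<Sum>c<n3. A $$ (i, a) * B $$ (j, b) * C $$ (k, c) * ?T a b c)" for i j k
    using carr by (simp add: tensor_action_def)
  \<comment> \<open>The column sums of \<open>A\<close> as weights amount to the all-ones vector in
    the first mode after \<open>A\<close> has acted.\<close>
  have eq1: "(\<Sum>a<n1. (\<Sum>i<r. A $$ (i, a)) * (\<Sum>b<n2. \<Sum>c<n3. B $$ (j, b) * C $$ (k, c) * ?T a b c))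
      = (\<Sum>i<r. tensor_action A B C ?T i j k)" for j k
    unfolding ta sum_distrib_right by (subst sum.swap) (simp add: sum_distrib_left mult_ac)
  have 1: "det (contraction r n1 n2 n3 (\<lambda>a. \<Sum>i<r. A $$ (i, a)) B C ?T) \<noteq> 0"
  proof (rule fls_det_ne_0_if_identity_at_0[of _ r])
    fix j k and m :: int
    assume lt: "j < r" "k < r" "m \<le> 0"
    have "fls_nth (\<Sum>i<r. tensor_action A B C ?T i j k) m =
        (\<Sum>i<r. if m = 0 \<and> i = j \<and> j = k then 1 else 0)"
      unfolding fls_nth_sum using lt by (intro sum.cong) (auto simp: nth)
    \<comment> \<open>Summing the unit tensor over one index leaves the identity matrix.\<close>
    also have "\<dots> = (if m = 0 \<and> j = k then 1 else 0)"
      using lt by (cases "m = 0 \<and> j = k") auto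
    finally show "fls_nth (contraction r n1 n2 n3 (\<lambda>a. \<Sum>i<r. A $$ (i, a)) B C ?T $$ (j, k)) m =
        (if m = 0 \<and> j = k then 1 else 0)"
      using lt by (simp add: contraction_def eq1)
  qed (simp add: contraction_def)
  have eq2: "(\<Sum>b<n2. (\<Sum>j<r. B $$ (j, b)) * (\<Sum>a<n1. \<Sum>c<n3. A $$ (i, a) * C $$ (k, c) * ?T a b c))
      = (\<Sum>j<r. tensor_action A B C ?T i j k)" for i k
  proof -
    have "(\<Sum>b<n2. (\<Sum>j<r. B $$ (j, b)) * (\<Sum>a<n1. \<Sum>c<n3. A $$ (i, a) * C $$ (k, c) * ?T a b c))
        = (\<Sum>j<r. \<Sum>b<n2. \<Sum>a<n1. \<Sum>c<n3. A $$ (i, a) * B $$ (j, b) * C $$ (k, c) * ?T a b c)"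
      unfolding sum_distrib_right by (subst sum.swap) (simp add: sum_distrib_left mult_ac)
    also have "\<dots> = (\<Sum>j<r. tensor_action A B C ?T i j k)"
      unfolding ta by (rule sum.cong[OF refl sum.swap])
    finally show ?thesis .
  qed
  have 2: "det (contraction r n2 n1 n3 (\<lambda>b. \<Sum>j<r. B $$ (j, b)) A C (\<lambda>b a c. ?T a b c)) \<noteq> 0"
  proof (rule fls_det_ne_0_if_identity_at_0[of _ r])
    fix i k and m :: int
    assume lt: "i < r" "k < r" "m \<le> 0"
    have "fls_nth (\<Sum>j<r. tensor_action A B C ?T i j k) m =
        (\<Sum>j<r. if m = 0 \<and> i = k \<and> j = k then 1 else 0)"
      unfolding fls_nth_sum using lt by (intro sum.cong) (auto simp: nth)
    also have "\<dots> = (if m = 0 \<and> i = k then 1 else 0)"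
      using lt by (cases "m = 0 \<and> i = k") auto
    finally show "fls_nth (contraction r n2 n1 n3 (\<lambda>b. \<Sum>j<r. B $$ (j, b)) A C (\<lambda>b a c. ?T a b c) $$ (i, k)) m =
        (if m = 0 \<and> i = k then 1 else 0)"
      using lt by (simp add: contraction_def eq2)
  qed (simp add: contraction_def)
  have eq3: "(\<Sum>c<n3. (\<Sum>k<r. C $$ (k, c)) * (\<Sum>a<n1. \<Sum>b<n2. A $$ (i, a) * B $$ (j, b) * ?T a b c))
      = (\<Sum>k<r. tensor_action A B C ?T i j k)" for i j
  proof -
    have "(\<Sum>c<n3. (\<Sum>k<r. C $$ (k, c)) * (\<Sum>a<n1. \<Sum>b<n2. A $$ (i, a) * B $$ (j, b) * ?T a b c))
        = (\<Sum>k<r. \<Sum>c<n3. \<Sum>a<n1. \<Sum>b<n2. A $$ (i, a) * B $$ (j, b) * C $$ (k, c) * ?T a b c)"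
      unfolding sum_distrib_right by (subst sum.swap) (simp add: sum_distrib_left mult_ac)
    \<comment> \<open>To reach the order of summation in \<open>tensor_action\<close>, the sum over
      \<open>c\<close> moves inward, past \<open>a\<close> here and past \<open>b\<close>
      next.\<close>
    also have "\<dots> = (\<Sum>k<r. \<Sum>a<n1. \<Sum>c<n3. \<Sum>b<n2. A $$ (i, a) * B $$ (j, b) * C $$ (k, c) * ?T a b c)"
      by (rule sum.cong[OF refl sum.swap])
    also have "\<dots> = (\<Sum>k<r. tensor_action A B C ?T i j k)"
      unfolding ta by (rule sum.cong[OF refl sum.cong[OF refl sum.swap]])
    finally show ?thesis .
  qed
  have 3: "det (contraction r n3 n1 n2 (\<lambda>c. \<Sum>k<r. C $$ (k, c)) A B (\<lambda>c a b. ?T a b c)) \<noteq> 0"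
  proof (rule fls_det_ne_0_if_identity_at_0[of _ r])
    fix i j and m :: int
    assume lt: "i < r" "j < r" "m \<le> 0"
    have "fls_nth (\<Sum>k<r. tensor_action A B C ?T i j k) m =
        (\<Sum>k<r. if m = 0 \<and> i = j \<and> j = k then 1 else 0)"
      unfolding fls_nth_sum using lt by (intro sum.cong) (auto simp: nth)
    also have "\<dots> = (if m = 0 \<and> i = j then 1 else 0)"
      using lt by (cases "m = 0 \<and> i = j") auto
    finally show "fls_nth (contraction r n3 n1 n2 (\<lambda>c. \<Sum>k<r. C $$ (k, c)) A B (\<lambda>c a b. ?T a b c) $$ (i, j)) m =
        (if m = 0 \<and> i = j then 1 else 0)"
      using lt by (simp add: contraction_def eq3)
  qed (simp add: contraction_def)
  show thesis by (rule that[OF carr 1 2 3])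
qed

text \<open>\<open>Max\<close> is attained because the set is finite, being bounded by
  \<open>n2\<close> through the first-mode contraction, and contains 0, where the condition on
  entries is vacuous.\<close>

lemma border_subrank_degenerates:
  "unit_tensor_degenerates n1 n2 n3 T (border_subrank n1 n2 n3 T)"
proof -
  have "r \<le> n2" if "unit_tensor_degenerates n1 n2 n3 T r" for r
    using that by (rule unit_tensor_degenerates_contractions) (rule contraction_det_ne_0_imp_le_dim)
  then have "finite {r. unit_tensor_degenerates n1 n2 n3 T r}"
    by (auto intro: finite_subset[of _ "{..n2}"])
  moreover have "unit_tensor_degenerates n1 n2 n3 T 0"
    by (auto simp: unit_tensor_degenerates_def laurent_polynomial_mats_def
        intro!: bexI[of _ "0\<^sub>m 0 _"])
  ultimately show ?thesis
    unfolding border_subrank_def using Max_in[of "{r. unit_tensor_degenerates n1 n2 n3 T r}"] by blast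
qed

theorem theorem5p15:
  fixes T :: "'a::field tensor" and n1 n2 n3 :: nat
  assumes "infinite (UNIV :: 'a set) \<or> card (UNIV :: 'a set) > border_subrank n1 n2 n3 T + 1"
  shows "\<forall>i \<in> {1, 2, 3}. border_subrank n1 n2 n3 T \<le> max_slice_rank i n1 n2 n3 T"
proof -
  let ?r = "border_subrank n1 n2 n3 T"
  have F: "infinite (UNIV :: 'a set) \<or> card (UNIV :: 'a set) > ?r" using assms by auto
  from border_subrank_degenerates[of n1 n2 n3 T]
  obtain A B C wa wb wc where
    carr: "A \<in> carrier_mat ?r n1" "B \<in> carrier_mat ?r n2" "C \<in> carrier_mat ?r n3" and
    det: "det (contraction ?r n1 n2 n3 wa B C (\<lambda>a b c. fls_const (T a b c))) \<noteq> 0"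
    "det (contraction ?r n2 n1 n3 wb A C (\<lambda>b a c. fls_const (T a b c))) \<noteq> 0"
    "det (contraction ?r n3 n1 n2 wc A B (\<lambda>c a b. fls_const (T a b c))) \<noteq> 0"
    by (rule unit_tensor_degenerates_contractions)
  show ?thesis
    \<comment> \<open>With the contracted mode as first argument of \<open>f\<close>, the matrices
      in the span are exactly the slices of that mode.\<close>
    using contraction_det_ne_0_imp_le_max_rank_span[OF carr(2,3) det(1) F]
      contraction_det_ne_0_imp_le_max_rank_span[OF carr(1,3) det(2) F]
      contraction_det_ne_0_imp_le_max_rank_span[OF carr(1,2) det(3) F]
    by (auto simp: max_slice_rank_def slices1_def slices2_def slices3_def)
qed

end
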